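(* Let $p$ and $q$ be two probability densities, let $l_0\in\mathbb{R}$ be a fixed location, and for $s>0$ let $p_s(x)=\frac{1}{s}p\left(\frac{x-l_0}{s}\right)$ and $q_s(x)=\frac{1}{s}q\left(\frac{x-l_0}{s}\right)$ be the densities of the two associated scale families, assumed to share the same support $\mathcal{X}$. Let $f$ be a convex function on $(0,\infty)$, strictly convex at $1$, with $f(1)=0$, and set $D_f(s_1:s_2):=I_f(p_{s_1}:q_{s_2})$ for $s_1,s_2>0$. Then for all $s_1,s_2>0$, $$D_f(s_1:s_2)=I_f\left(p_1:q_{\frac{s_2}{s_1}}\right)=D_f\left(1:\frac{s_2}{s_1}\right),\qquad D_f(s_1:s_2)=I_f\left(p_{\frac{s_1}{s_2}}:q_1\right)=D_f\left(\frac{s_1}{s_2}:1\right).$$ In particular the $f$-divergence between two scale densities depends only on the ratio of the scales.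
   Context: All densities are probability densities with respect to Lebesgue measure on $\mathbb{R}$. A density has support $\mathcal{X}\subseteq\mathbb{R}$ if it is positive on $\mathcal{X}$ and zero outside; the two scale families share the same support $\mathcal{X}$ means that all their members have support $\mathcal{X}$. For two densities $p,q$ with support $\mathcal{X}$, the $f$-divergence is $I_f(p:q)=\int_{\mathcal{X}}p(x)\,f\left(\frac{q(x)}{p(x)}\right)dx\in[0,+\infty]$. *)

theory Defs
  imports "HOL-Analysis.Analysis"
begin

definition prob_density :: "(real \<Rightarrow> real) \<Rightarrow> bool" where
  "prob_density p \<longleftrightarrow>
     p \<in> borel_measurable lebesgue \<and> (\<forall>x. 0 \<le> p x) \<and> (\<integral>\<^sup>+x. ennreal (p x) \<partial>lebesgue) = 1"

definition has_support :: "(real \<Rightarrow> real) \<Rightarrow> real set \<Rightarrow> bool" where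
  "has_support p X \<longleftrightarrow> (\<forall>x\<in>X. 0 < p x) \<and> (\<forall>x. x \<notin> X \<longrightarrow> p x = 0)"

definition scale_density :: "(real \<Rightarrow> real) \<Rightarrow> real \<Rightarrow> real \<Rightarrow> real \<Rightarrow> real" where
  "scale_density p l s x = (1 / s) * p ((x - l) / s)"

definition strictly_convex_at :: "real \<Rightarrow> (real \<Rightarrow> real) \<Rightarrow> bool" where
  "strictly_convex_at c f \<longleftrightarrow>
     (\<forall>u>0. \<forall>v>0. \<forall>t. u \<noteq> v \<and> 0 < t \<and> t < 1 \<and> (1 - t) * u + t * v = c
        \<longrightarrow> f c < (1 - t) * f u + t * f v)"

text \<open>
  The integrand of the divergence may be negative and the integral may be infinite, so it is
  the integral of the positive part minus that of the negative part
  (\<^const>\<open>ennreal\<close> sends negative reals to 0). The lemmas below show that, for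
  convex \<open>f\<close> with \<open>f 1 = 0\<close>, the second integral is finite, so that no
  difference of infinities occurs, and that the value is nonnegative.
\<close>

definition f_divergence ::
  "(real \<Rightarrow> real) \<Rightarrow> real set \<Rightarrow> (real \<Rightarrow> real) \<Rightarrow> (real \<Rightarrow> real) \<Rightarrow> ereal" where
  "f_divergence f X p q =
     enn2ereal (\<integral>\<^sup>+x\<in>X. ennreal (p x * f (q x / p x)) \<partial>lebesgue)
     - enn2ereal (\<integral>\<^sup>+x\<in>X. ennreal (- (p x * f (q x / p x))) \<partial>lebesgue)"

definition scale_divergence ::
  "(real \<Rightarrow> real) \<Rightarrow> real set \<Rightarrow> real \<Rightarrow> (real \<Rightarrow> real) \<Rightarrow> (real \<Rightarrow> real) \<Rightarrow> real \<Rightarrow> real \<Rightarrow> ereal" where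
  "scale_divergence f X l p q s\<^sub>1 s\<^sub>2 =
     f_divergence f X (scale_density p l s\<^sub>1) (scale_density q l s\<^sub>2)"

lemma
  assumes p: "prob_density p" "has_support p X"
    and q: "prob_density q" "has_support q X"
    and f: "convex_on {0<..} f" "f 1 = 0"
  shows f_divergence_neg_part_finite:
      "(\<integral>\<^sup>+x\<in>X. ennreal (- (p x * f (q x / p x))) \<partial>lebesgue) < \<infinity>"
    and f_divergence_nonneg: "0 \<le> f_divergence f X p q"
proof -
  obtain a where a: "a * (y - 1) \<le> f y" if "y > 0" for y
  proof
    show "Inf ((\<lambda>t. (f 1 - f t) / (1 - t)) ` ({1<..} \<inter> {0<..})) * (y - 1) \<le> f y"
      if "y > 0" for y
      using convex_le_Inf_differential[OF f(1), of 1 y] that f(2)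
      by (simp add: interior_open)
  qed
  define h where "h x = a * (q x - p x)" for x
  have ip: "integrable lebesgue p" "integral\<^sup>L lebesgue p = 1"
    and iq: "integrable lebesgue q" "integral\<^sup>L lebesgue q = 1"
    using p(1) q(1) unfolding prob_density_def
    by (auto intro!: integrableI_nonneg simp: integral_eq_nn_integral)
  have ih: "integrable lebesgue h" "integral\<^sup>L lebesgue h = 0"
    unfolding h_def using ip iq by auto
  have fin: "(\<integral>\<^sup>+x. ennreal (h x) \<partial>lebesgue) \<noteq> \<infinity>" "(\<integral>\<^sup>+x. ennreal (- h x) \<partial>lebesgue) \<noteq> \<infinity>"
    using ih(1) by (auto simp: real_integrable_def)
  have eq: "(\<integral>\<^sup>+x. ennreal (h x) \<partial>lebesgue) = (\<integral>\<^sup>+x. ennreal (- h x) \<partial>lebesgue)"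
    using real_lebesgue_integral_def[OF ih(1)] ih(2) fin
    by (metis ennreal_enn2real_if eq_iff_diff_eq_0 infinity_ennreal_def)
  have hle: "h x \<le> p x * f (q x / p x)" if "x \<in> X" for x
  proof -
    have pos: "0 < p x" "0 < q x" using that p(2) q(2) by (auto simp: has_support_def)
    have "p x * (a * (q x / p x - 1)) \<le> p x * f (q x / p x)"
      using a[of "q x / p x"] pos by (intro mult_left_mono) auto
    moreover have "p x * (a * (q x / p x - 1)) = h x"
      using pos by (simp add: h_def field_simps)
    ultimately show ?thesis by simp
  qed
  have h0: "h x = 0" if "x \<notin> X" for x
    using that p(2) q(2) by (auto simp: h_def has_support_def)
  have le1: "(\<integral>\<^sup>+x. ennreal (h x) \<partial>lebesgue)
      \<le> (\<integral>\<^sup>+x\<in>X. ennreal (p x * f (q x / p x)) \<partial>lebesgue)"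
    by (intro nn_integral_mono) (auto simp: indicator_def hle h0 intro: ennreal_leI)
  have le2: "(\<integral>\<^sup>+x\<in>X. ennreal (- (p x * f (q x / p x))) \<partial>lebesgue)
      \<le> (\<integral>\<^sup>+x. ennreal (- h x) \<partial>lebesgue)"
    by (intro nn_integral_mono) (auto simp: indicator_def hle h0 intro: ennreal_leI)
  show "(\<integral>\<^sup>+x\<in>X. ennreal (- (p x * f (q x / p x))) \<partial>lebesgue) < \<infinity>"
    using le2 fin(2) by (simp add: order_le_less_trans top.not_eq_extremum)
  then show "0 \<le> f_divergence f X p q"
    unfolding f_divergence_def using le1 le2 eq
    by (intro ereal_diff_positive) (simp add: less_eq_ennreal.rep_eq[symmetric])
qed

end

theory Submission
  imports Defs
begin

text \<open>
  The divergence is an integral, so it is unchanged by a change of variables, and the dilation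
  \<open>x \<mapsto> l + c (x - l)\<close> about the common location carries each scale family into itself: it
  multiplies the scale by \<open>c\<close>. Dividing both scales by the same \<open>c > 0\<close> therefore does not change the
  divergence (\<open>scale_divergence_rescale\<close>); \<open>c = s\<^sub>1\<close> and \<open>c = s\<^sub>2\<close> give the two displayed formulas, and
  the second of them shows that only the ratio matters.

  Two points need care. The integral is taken over the fixed set \<open>X\<close>, and \<open>X\<close> must be carried to itself
  by the dilation; this is what the assumption that all members of a family have support \<open>X\<close>
  provides (\<open>dilation_mem_support_iff\<close>). Secondly, the change of variables is proved for
  arbitrary integrands (\<open>nn_integral_lebesgue_affine\<close>): an affine bijection and its inverse are both
  Lebesgue measurable, so precomposition matches the simple functions below an integrand with
  those below the transformed one, and measurability questions about \<open>f (q x / p x)\<close> do not arise.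
\<close>

text \<open>
  The integral of a function is the supremum over the simple functions below it, and
  precomposing these with a measurable map again gives measurable functions.
  With the factor inside the integral, the right-hand side is again the integral of a function, to
  which the same estimate applies with the inverse map.
\<close>

lemma nn_integral_lebesgue_affine_le:
  fixes g :: "real \<Rightarrow> ennreal" and c t :: real
  assumes c: "c \<noteq> 0"
  shows "(\<integral>\<^sup>+x. g x \<partial>lebesgue) \<le> (\<integral>\<^sup>+x. ennreal \<bar>c\<bar> * g (t + c * x) \<partial>lebesgue)"
  unfolding nn_integral_def[of lebesgue g]
proof (rule SUP_least, clarify)
  fix u :: "real \<Rightarrow> ennreal"
  assume u: "simple_function lebesgue u" and le: "u \<le> g"
  have T: "(\<lambda>x. t + c * x) \<in> lebesgue \<rightarrow>\<^sub>M lebesgue"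
    using lebesgue_affine_measurable[of "\<lambda>_. c" t] c by simp
  have [measurable]: "u \<in> borel_measurable lebesgue"
    using u by (rule borel_measurable_simple_function)
  have uT: "(\<lambda>x. u (t + c * x)) \<in> borel_measurable lebesgue"
    using T by (rule measurable_compose) simp
  have "integral\<^sup>S lebesgue u = (\<integral>\<^sup>+x. u x \<partial>lebesgue)"
    using u by (simp add: nn_integral_eq_simple_integral)
  also have "\<dots> = (\<integral>\<^sup>+x. ennreal \<bar>c\<bar> * u (t + c * x) \<partial>lebesgue)"
    using c uT by (simp add: nn_integral_real_affine_lebesgue[of u c t] nn_integral_cmult)
  also have "\<dots> \<le> (\<integral>\<^sup>+x. ennreal \<bar>c\<bar> * g (t + c * x) \<partial>lebesgue)"
    using le by (intro nn_integral_mono mult_left_mono) (auto simp: le_fun_def)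
  finally show "integral\<^sup>S lebesgue u \<le> (\<integral>\<^sup>+x. ennreal \<bar>c\<bar> * g (t + c * x) \<partial>lebesgue)" .
qed

text \<open>Equality, because the inverse map is affine too and the two factors cancel.\<close>

lemma nn_integral_lebesgue_affine:
  fixes g :: "real \<Rightarrow> ennreal" and c t :: real
  assumes c: "c \<noteq> 0"
  shows "(\<integral>\<^sup>+x. g x \<partial>lebesgue) = (\<integral>\<^sup>+x. ennreal \<bar>c\<bar> * g (t + c * x) \<partial>lebesgue)"
proof (rule antisym[OF nn_integral_lebesgue_affine_le[OF c]])
  have cancel: "ennreal \<bar>1 / c\<bar> * (ennreal \<bar>c\<bar> * g (t + c * (- t / c + 1 / c * x))) = g x" for x
  proof -
    have "t + c * (- t / c + 1 / c * x) = x"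
      using c by (simp add: field_simps)
    moreover have "ennreal \<bar>1 / c\<bar> * ennreal \<bar>c\<bar> = 1"
      using c by (simp flip: ennreal_mult)
    ultimately show ?thesis
      by (simp only: mult.assoc[symmetric] mult_1)
  qed
  show "(\<integral>\<^sup>+x. ennreal \<bar>c\<bar> * g (t + c * x) \<partial>lebesgue) \<le> (\<integral>\<^sup>+x. g x \<partial>lebesgue)"
    using nn_integral_lebesgue_affine_le[of "1 / c" "\<lambda>x. ennreal \<bar>c\<bar> * g (t + c * x)" "- t / c"] c
    unfolding cancel by simp
qed

text \<open>
  The value of the density of scale \<open>c\<close> at the dilated point and that of the density of scale 1 at
  \<open>x\<close> are both positive multiples of \<open>p (x - l)\<close>.
\<close>

lemma dilation_mem_support_iff:
  assumes supp: "\<And>s. s > 0 \<Longrightarrow> has_support (scale_density p l s) X" and c: "c > 0"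
  shows "l + c * (x - l) \<in> X \<longleftrightarrow> x \<in> X"
proof -
  have iff: "y \<in> X \<longleftrightarrow> 0 < scale_density p l s y" if "s > 0" for y s
    using supp[OF that] unfolding has_support_def by force
  show ?thesis
    using iff[of 1 x] iff[of c "l + c * (x - l)"] c
    by (simp add: scale_density_def zero_less_divide_iff)
qed

lemma scale_density_dilation:
  assumes "c > 0"
  shows "scale_density p l s (l + c * (x - l)) = scale_density p l (s / c) x / c"
  using assms by (simp add: scale_density_def mult.commute)

text \<open>
  The ratio of the densities is constant along the dilation, while the factor \<open>1 / c\<close> of the weight
  cancels the Jacobian \<open>c\<close>. The sign \<open>k\<close> allows one computation to serve for the positive and
  the negative part.
\<close>

lemma nn_integral_scale_density_rescale:
  fixes p q f :: "real \<Rightarrow> real" and c k :: real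
  assumes supp: "\<And>s. s > 0 \<Longrightarrow> has_support (scale_density p l s) X" and c: "c > 0"
  defines "F \<equiv> \<lambda>s\<^sub>1 s\<^sub>2 x. k * (scale_density p l s\<^sub>1 x
      * f (scale_density q l s\<^sub>2 x / scale_density p l s\<^sub>1 x))"
  shows "(\<integral>\<^sup>+x\<in>X. ennreal (F s\<^sub>1 s\<^sub>2 x) \<partial>lebesgue)
    = (\<integral>\<^sup>+x\<in>X. ennreal (F (s\<^sub>1 / c) (s\<^sub>2 / c) x) \<partial>lebesgue)"
proof -
  have "(\<integral>\<^sup>+x\<in>X. ennreal (F s\<^sub>1 s\<^sub>2 x) \<partial>lebesgue)
    = (\<integral>\<^sup>+x. ennreal \<bar>c\<bar> * (ennreal (F s\<^sub>1 s\<^sub>2 ((l - c * l) + c * x))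
        * indicator X ((l - c * l) + c * x)) \<partial>lebesgue)"
    using c by (intro nn_integral_lebesgue_affine) simp
  also have "\<dots> = (\<integral>\<^sup>+x\<in>X. ennreal (F (s\<^sub>1 / c) (s\<^sub>2 / c) x) \<partial>lebesgue)"
  proof (rule nn_integral_cong)
    fix x
    have affine: "(l - c * l) + c * x = l + c * (x - l)"
      by (simp add: algebra_simps)
    have "c * F s\<^sub>1 s\<^sub>2 (l + c * (x - l)) = F (s\<^sub>1 / c) (s\<^sub>2 / c) x"
      unfolding F_def scale_density_dilation[OF c] using c by simp
    then have weight: "ennreal \<bar>c\<bar> * ennreal (F s\<^sub>1 s\<^sub>2 (l + c * (x - l)))
        = ennreal (F (s\<^sub>1 / c) (s\<^sub>2 / c) x)"
      using c by (simp flip: ennreal_mult')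
    have ind: "indicator X (l + c * (x - l)) = (indicator X x :: ennreal)"
      using dilation_mem_support_iff[OF supp c] by (simp add: indicator_def)
    show "ennreal \<bar>c\<bar> * (ennreal (F s\<^sub>1 s\<^sub>2 ((l - c * l) + c * x)) * indicator X ((l - c * l) + c * x))
        = ennreal (F (s\<^sub>1 / c) (s\<^sub>2 / c) x) * indicator X x"
      unfolding affine ind mult.assoc[symmetric] weight ..
  qed
  finally show ?thesis .
qed

lemma scale_divergence_rescale:
  assumes "\<And>s. s > 0 \<Longrightarrow> has_support (scale_density p l s) X" and "c > 0"
  shows "scale_divergence f X l p q s\<^sub>1 s\<^sub>2 = scale_divergence f X l p q (s\<^sub>1 / c) (s\<^sub>2 / c)"
  using nn_integral_scale_density_rescale[OF assms, where k = 1 and f = f and q = q]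
    nn_integral_scale_density_rescale[OF assms, where k = "- 1" and f = f and q = q]
  by (simp add: scale_divergence_def f_divergence_def)

theorem mainTheorem3:
  fixes p q f :: "real \<Rightarrow> real" and l\<^sub>0 :: real and X :: "real set"
  assumes "prob_density p" and "prob_density q"
    and "\<And>s. s > 0 \<Longrightarrow> has_support (scale_density p l\<^sub>0 s) X"
    and "\<And>s. s > 0 \<Longrightarrow> has_support (scale_density q l\<^sub>0 s) X"
    and "convex_on {0<..} f" and "strictly_convex_at 1 f" and "f 1 = 0"
  shows "(\<forall>s\<^sub>1>0. \<forall>s\<^sub>2>0.
      scale_divergence f X l\<^sub>0 p q s\<^sub>1 s\<^sub>2
        = f_divergence f X (scale_density p l\<^sub>0 1) (scale_density q l\<^sub>0 (s\<^sub>2 / s\<^sub>1)) \<and>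
      f_divergence f X (scale_density p l\<^sub>0 1) (scale_density q l\<^sub>0 (s\<^sub>2 / s\<^sub>1))
        = scale_divergence f X l\<^sub>0 p q 1 (s\<^sub>2 / s\<^sub>1) \<and>
      scale_divergence f X l\<^sub>0 p q s\<^sub>1 s\<^sub>2
        = f_divergence f X (scale_density p l\<^sub>0 (s\<^sub>1 / s\<^sub>2)) (scale_density q l\<^sub>0 1) \<and>
      f_divergence f X (scale_density p l\<^sub>0 (s\<^sub>1 / s\<^sub>2)) (scale_density q l\<^sub>0 1)
        = scale_divergence f X l\<^sub>0 p q (s\<^sub>1 / s\<^sub>2) 1) \<and>
    (\<forall>s\<^sub>1>0. \<forall>s\<^sub>2>0. \<forall>t\<^sub>1>0. \<forall>t\<^sub>2>0. s\<^sub>1 / s\<^sub>2 = t\<^sub>1 / t\<^sub>2 \<longrightarrow>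
      scale_divergence f X l\<^sub>0 p q s\<^sub>1 s\<^sub>2 = scale_divergence f X l\<^sub>0 p q t\<^sub>1 t\<^sub>2)"
proof -
  have rescale: "scale_divergence f X l\<^sub>0 p q s\<^sub>1 s\<^sub>2 = scale_divergence f X l\<^sub>0 p q (s\<^sub>1 / c) (s\<^sub>2 / c)"
    if "c > 0" for s\<^sub>1 s\<^sub>2 c
    using assms(3) that by (rule scale_divergence_rescale)
  have first: "scale_divergence f X l\<^sub>0 p q s\<^sub>1 s\<^sub>2 = scale_divergence f X l\<^sub>0 p q 1 (s\<^sub>2 / s\<^sub>1)"
    if "s\<^sub>1 > 0" for s\<^sub>1 s\<^sub>2
    using rescale[OF that, of s\<^sub>1 s\<^sub>2] that by simp
  have second: "scale_divergence f X l\<^sub>0 p q s\<^sub>1 s\<^sub>2 = scale_divergence f X l\<^sub>0 p q (s\<^sub>1 / s\<^sub>2) 1"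
    if "s\<^sub>2 > 0" for s\<^sub>1 s\<^sub>2
    using rescale[OF that, of s\<^sub>1 s\<^sub>2] that by simp
  show ?thesis
  proof (intro conjI allI impI)
    fix s\<^sub>1 s\<^sub>2 t\<^sub>1 t\<^sub>2 :: real
    assume "s\<^sub>2 > 0" "t\<^sub>2 > 0" "s\<^sub>1 / s\<^sub>2 = t\<^sub>1 / t\<^sub>2"
    then show "scale_divergence f X l\<^sub>0 p q s\<^sub>1 s\<^sub>2 = scale_divergence f X l\<^sub>0 p q t\<^sub>1 t\<^sub>2"
      using second[of s\<^sub>2 s\<^sub>1] second[of t\<^sub>2 t\<^sub>1] by simp
  qed (simp_all only: first[symmetric] second[symmetric] flip: scale_divergence_def)
qed

end
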